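(* Let $F\colon \mathbf{R}^{n}\rightrightarrows\mathbf{R}^{m}$ be a set-valued mapping and let $\{\mathcal{M}_i\}$ be a Whitney (a)-regular $C^1$-stratification of the graph $\mathrm{gph}\,F\subset\mathbf{R}^n\times\mathbf{R}^m$. Then for any pair $(\bar x,\bar y)\in\mathrm{gph}\,F$ lying in a stratum $\mathcal{M}_i$ and any $u\in\mathbf{R}^m$, the orthogonality relation $$\mathrm{par}\, D^{*}_{c}F(\bar x|\bar y)(u)\ \perp\ \pi_{x}\Big(T_{\mathcal{M}_i}(\bar x,\bar y)\Big)$$ holds.
   Context: A set-valued mapping $F\colon\mathbf{R}^n\rightrightarrows\mathbf{R}^m$ assigns to each $x$ a subset $F(x)\subset\mathbf{R}^m$; $\mathrm{gph}\,F=\{(x,y):y\in F(x)\}$. For a set $Q$, $\mathrm{par}\,Q$ is the linear span of $Q-Q$. $Q\perp L$ means every element of $Q$ is orthogonal to every element of $L$. $\pi_x$ is the coordinate projection $(x,y)\mapsto x$, and $T_{\mathcal M}(z)$ is the tangent space to a manifold $\mathcal M$ at $z$. Normal cones. For $Q\subset\mathbf{R}^k$ and $\bar x\in Q$: the Fréchet normal cone $\hat N_Q(\bar x)$ is the set of $v$ with $\langle v,x-\bar x\rangle\le o(\|x-\bar x\|)$ for $x\in Q$ (where $o(\|x-\bar x\|)/\|x-\bar x\|\to0$ as $x\to\bar x$ in $Q$); the limiting normal cone $N_Q(\bar x)$ is the set of limits $v=\lim v_i$ with $v_i\in\hat N_Q(x_i)$, $x_i\in Q$, $x_i\to\bar x$;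 the Clarke normal cone is $N^c_Q(\bar x)=\mathrm{cl}\,\mathrm{conv}\,N_Q(\bar x)$. For a $C^1$ manifold these are all the usual normal space. The Clarke coderivative of $F$ at $\bar x$ for $\bar y\in F(\bar x)$ is the set-valued map $D^*_cF(\bar x|\bar y)\colon\mathbf{R}^m\rightrightarrows\mathbf{R}^n$, $D^*_cF(\bar x|\bar y)(u)=\{v:(v,-u)\in N^c_{\mathrm{gph}\,F}(\bar x,\bar y)\}$. A Whitney (a)-regular $C^p$-stratification of a set $Q\subset \mathbf{R}^k$ is a partition of $Q$ into finitely many $C^p$ manifolds (strata) such that: (frontier condition) for any two distinct strata $L,M$, if $L\cap\mathrm{cl}\,M\ne\emptyset$ then $L\subset(\mathrm{cl}\,M)\setminus M$; (Whitney condition (a)) for any sequence $x_i$ in a stratum $M$ converging to a point $\bar x$ in a stratum $L$, if normal vectors $v_i\in N_M(x_i)$ converge to $v$, then $v\in N_L(\bar x)$. *)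

theory Defs
  imports "HOL-Analysis.Analysis"
begin

definition gph :: "('a \<Rightarrow> 'b set) \<Rightarrow> ('a \<times> 'b) set" where
  "gph F = {(x, y). y \<in> F x}"

definition par :: "'a::real_vector set \<Rightarrow> 'a set" where
  "par Q = span {a - b | a b. a \<in> Q \<and> b \<in> Q}"

text \<open>The function \<open>r\<close> is the remainder \<open>o(norm (x - xb))\<close> as \<open>x\<close> tends to \<open>xb\<close> in \<open>Q\<close>.\<close>

definition frechet_normal_cone :: "'a::euclidean_space set \<Rightarrow> 'a \<Rightarrow> 'a set" where
  "frechet_normal_cone Q xb =
     {v. \<exists>r::'a \<Rightarrow> real.
           (\<forall>x\<in>Q. v \<bullet> (x - xb) \<le> r x) \<and>
           ((\<lambda>x. r x / norm (x - xb)) \<longlongrightarrow> 0) (at xb within Q)}"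

definition limiting_normal_cone :: "'a::euclidean_space set \<Rightarrow> 'a \<Rightarrow> 'a set" where
  "limiting_normal_cone Q xb =
     {v. \<exists>x w. (\<forall>i::nat. x i \<in> Q \<and> w i \<in> frechet_normal_cone Q (x i)) \<and>
               x \<longlonglongrightarrow> xb \<and> w \<longlonglongrightarrow> v}"

definition clarke_normal_cone :: "'a::euclidean_space set \<Rightarrow> 'a \<Rightarrow> 'a set" where
  "clarke_normal_cone Q xb = closure (convex hull (limiting_normal_cone Q xb))"

definition clarke_coderivative ::
    "('a::euclidean_space \<Rightarrow> 'b::euclidean_space set) \<Rightarrow> 'a \<Rightarrow> 'b \<Rightarrow> 'b \<Rightarrow> 'a set" where
  "clarke_coderivative F xb yb u = {v. (v, - u) \<in> clarke_normal_cone (gph F) (xb, yb)}"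

definition C1_map_on :: "'a::euclidean_space set \<Rightarrow> ('a \<Rightarrow> 'b::euclidean_space) \<Rightarrow> bool" where
  "C1_map_on U f \<longleftrightarrow>
     (\<exists>f' :: 'a \<Rightarrow> 'a \<Rightarrow>\<^sub>L 'b.
        (\<forall>x\<in>U. (f has_derivative blinfun_apply (f' x)) (at x)) \<and> continuous_on U f')"

text \<open>
  Embedded submanifolds via slice charts: near each of its points the set is mapped onto a
  relatively open piece of a linear subspace by a diffeomorphism of class \<open>C1\<close> of the ambient
  space. The dimension of the subspace is locally constant, but it may differ between
  connected components.
\<close>

definition C1_manifold :: "'a::euclidean_space set \<Rightarrow> bool" where
  "C1_manifold M \<longleftrightarrow>
     (\<forall>z\<in>M. \<exists>U V \<phi> \<psi> (S :: 'a set).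
        open U \<and> z \<in> U \<and> open V \<and> homeomorphism U V \<phi> \<psi> \<and>
        C1_map_on U \<phi> \<and> C1_map_on V \<psi> \<and>
        subspace S \<and> \<phi> ` (M \<inter> U) = S \<inter> V)"

text \<open>Velocities at \<open>z\<close> of the curves of class \<open>C1\<close> that run in \<open>M\<close> and pass through \<open>z\<close> at time 0.\<close>

definition tangent_space :: "'a::euclidean_space set \<Rightarrow> 'a \<Rightarrow> 'a set" where
  "tangent_space M z =
     {v. \<exists>\<gamma> e. 0 < e \<and> \<gamma> C1_differentiable_on {-e<..<e} \<and> \<gamma> ` {-e<..<e} \<subseteq> M \<and>
               \<gamma> 0 = z \<and> (\<gamma> has_vector_derivative v) (at 0)}"

definition frontier_condition :: "'a::topological_space set set \<Rightarrow> bool" where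
  "frontier_condition \<S> \<longleftrightarrow>
     (\<forall>L\<in>\<S>. \<forall>M\<in>\<S>. L \<noteq> M \<and> L \<inter> closure M \<noteq> {} \<longrightarrow> L \<subseteq> closure M - M)"

text \<open>
  For a manifold \<open>M\<close> of class \<open>C1\<close> the limiting normal cone is the usual normal space.
\<close>

definition whitney_condition_a :: "'a::euclidean_space set set \<Rightarrow> bool" where
  "whitney_condition_a \<S> \<longleftrightarrow>
     (\<forall>L\<in>\<S>. \<forall>M\<in>\<S>. \<forall>(x :: nat \<Rightarrow> 'a) xb v vb.
        (\<forall>i. x i \<in> M) \<and> x \<longlonglongrightarrow> xb \<and> xb \<in> L \<and>
        (\<forall>i. v i \<in> limiting_normal_cone M (x i)) \<and> v \<longlonglongrightarrow> vb
        \<longrightarrow> vb \<in> limiting_normal_cone L xb)"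

definition whitney_a_C1_stratification ::
    "'a::euclidean_space set \<Rightarrow> 'a set set \<Rightarrow> bool" where
  "whitney_a_C1_stratification Q \<S> \<longleftrightarrow>
     finite \<S> \<and> partition_on Q \<S> \<and> (\<forall>M\<in>\<S>. C1_manifold M) \<and>
     frontier_condition \<S> \<and> whitney_condition_a \<S>"

end

(* A Frechet normal to the graph at a point of a stratum K is a Frechet normal to K, and one of the
   finitely many strata contains infinitely many members of any sequence in the graph. Whitney's
   condition (a) therefore makes every limiting normal to the graph at a point of M a limiting normal
   to M, which is orthogonal to the tangent space of M. This survives closed convex hulls, and the
   difference of two elements (a, -u) and (b, -u) of the Clarke normal cone has second component 0. *)
theory Submission
  imports Defs
begin

section \<open>Frechet normals and velocities of curves\<close>

lemma frechet_normal_cone_eventually: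
  assumes "w \<in> frechet_normal_cone Q x" and "0 < e"
  shows "\<forall>\<^sub>F y in nhds x. y \<in> Q \<longrightarrow> w \<bullet> (y - x) \<le> e * norm (y - x)"
proof -
  obtain r where r: "\<And>y. y \<in> Q \<Longrightarrow> w \<bullet> (y - x) \<le> r y"
    and lim: "((\<lambda>y. r y / norm (y - x)) \<longlongrightarrow> 0) (at x within Q)"
    using assms(1) unfolding frechet_normal_cone_def by blast
  have "\<forall>\<^sub>F y in at x within Q. r y / norm (y - x) < e"
    using order_tendstoD(2)[OF lim assms(2)] .
  then have "\<forall>\<^sub>F y in nhds x. y \<noteq> x \<longrightarrow> y \<in> Q \<longrightarrow> r y / norm (y - x) < e"
    by (simp add: eventually_at_filter)
  then show ?thesis
  proof eventually_elim
    case (elim y)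
    \<comment> \<open>At \<open>y = x\<close> both sides are 0, so the estimate holds on a full
      neighbourhood rather than a punctured one. It can then be composed with a curve that may
      return to \<open>x\<close>.\<close>
    show ?case
    proof (cases "y = x")
      case False
      then show ?thesis
        using elim r[of y] by (auto simp: pos_divide_less_eq)
    qed simp
  qed
qed

lemma frechet_normal_cone_antimono:
  assumes "w \<in> frechet_normal_cone Q x" and "K \<subseteq> Q"
  shows "w \<in> frechet_normal_cone K x"
  using assms unfolding frechet_normal_cone_def by (blast intro: tendsto_within_subset)

lemma frechet_normal_cone_subset_limiting:
  assumes "x \<in> Q"
  shows "frechet_normal_cone Q x \<subseteq> limiting_normal_cone Q x"
proof
  fix w assume "w \<in> frechet_normal_cone Q x"
  with assms show "w \<in> limiting_normal_cone Q x"
    unfolding limiting_normal_cone_def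
    by (intro CollectI exI[of _ "\<lambda>_. x"] exI[of _ "\<lambda>_. w"]) auto
qed

lemma has_vector_derivative_imp_tendsto_quotient:
  assumes "(f has_vector_derivative d) (at x)"
  shows "((\<lambda>y. (f y - f x) /\<^sub>R (y - x)) \<longlongrightarrow> d) (at x)"
proof -
  have "((\<lambda>y. norm (f y - f x - (y - x) *\<^sub>R d) / norm (y - x)) \<longlongrightarrow> 0) (at x)"
    using assms by (simp add: has_vector_derivative_def has_derivative_iff_norm)
  moreover have "\<forall>\<^sub>F y in at x. norm (f y - f x - (y - x) *\<^sub>R d) / norm (y - x) =
      norm ((f y - f x) /\<^sub>R (y - x) - d)"
  proof (rule eventually_at_filter[THEN iffD2], rule always_eventually, intro allI impI)
    fix y assume "y \<noteq> x"
    then have "(f y - f x) /\<^sub>R (y - x) - d = (f y - f x - (y - x) *\<^sub>R d) /\<^sub>R (y - x)"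
      by (simp add: scaleR_diff_right)
    then show "norm (f y - f x - (y - x) *\<^sub>R d) / norm (y - x) =
        norm ((f y - f x) /\<^sub>R (y - x) - d)"
      by (simp add: divide_inverse_commute)
  qed
  ultimately have "((\<lambda>y. norm ((f y - f x) /\<^sub>R (y - x) - d)) \<longlongrightarrow> 0) (at x)"
    by (rule Lim_transform_eventually)
  then show ?thesis
    by (simp add: tendsto_norm_zero_iff LIM_zero_iff)
qed

text \<open>For \<open>s > 0\<close> the normal inequality along the curve may be divided by
  \<open>s\<close>. The limit of the difference quotients gives
  \<open>w \<bullet> d \<le> e * norm d\<close> for each \<open>e > 0\<close>, and then
  \<open>e\<close> tends to 0.\<close>

lemma frechet_normal_cone_inner_velocity_le:
  assumes w: "w \<in> frechet_normal_cone Q x"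
    and c: "(c has_vector_derivative d) (at 0)" "c 0 = x"
    and cQ: "\<forall>\<^sub>F s in at (0::real). c s \<in> Q"
  shows "w \<bullet> d \<le> 0"
proof -
  have "((\<lambda>s. (c s - x) /\<^sub>R s) \<longlongrightarrow> d) (at 0)"
    using has_vector_derivative_imp_tendsto_quotient[OF c(1)] c(2) by simp
  then have lim: "((\<lambda>s. (c s - x) /\<^sub>R s) \<longlongrightarrow> d) (at_right 0)"
    by (rule tendsto_within_subset) simp
  have cont: "(c \<longlongrightarrow> x) (at_right 0)"
    using has_vector_derivative_continuous[OF c(1)] c(2)
    by (metis continuous_within tendsto_within_subset top_greatest)
  have bound: "w \<bullet> d \<le> e * norm d" if "0 < e" for e
  proof (rule tendsto_le)
    show "((\<lambda>s. w \<bullet> ((c s - x) /\<^sub>R s)) \<longlongrightarrow> w \<bullet> d) (at_right 0)"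
      using lim by (intro tendsto_intros)
    show "((\<lambda>s. e * norm ((c s - x) /\<^sub>R s)) \<longlongrightarrow> e * norm d) (at_right 0)"
      using lim by (intro tendsto_intros)
    have "\<forall>\<^sub>F s in at_right 0. c s \<in> Q \<longrightarrow> w \<bullet> (c s - x) \<le> e * norm (c s - x)"
      using filterlim_iff[THEN iffD1, OF cont] frechet_normal_cone_eventually[OF w that] by blast
    moreover have "\<forall>\<^sub>F s in at_right 0. c s \<in> Q"
      using cQ by (rule filter_leD[OF at_le[OF subset_UNIV]])
    moreover have "\<forall>\<^sub>F s in at_right (0::real). 0 < s"
      by (simp add: eventually_at_right_less)
    ultimately show "\<forall>\<^sub>F s in at_right 0. w \<bullet> ((c s - x) /\<^sub>R s) \<le> e * norm ((c s - x) /\<^sub>R s)"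
      by eventually_elim (auto simp: divide_simps)
  qed simp
  show ?thesis
  proof (rule tendsto_lowerbound)
    show "((\<lambda>e. e * norm d) \<longlongrightarrow> 0) (at_right 0)"
      by (rule tendsto_eq_intros refl)+ simp
    show "\<forall>\<^sub>F e in at_right 0. w \<bullet> d \<le> e * norm d"
      using eventually_at_right_less[of 0] by eventually_elim (rule bound)
  qed simp
qed

lemma frechet_normal_cone_inner_velocity:
  assumes w: "w \<in> frechet_normal_cone Q x"
    and c: "(c has_vector_derivative d) (at 0)" "c 0 = x"
    and cQ: "\<forall>\<^sub>F s in at (0::real). c s \<in> Q"
  shows "w \<bullet> d = 0"
proof -
  \<comment> \<open>The curve run backwards has velocity \<open>- d\<close>, so the one-sided bound
    applied to it supplies the reverse inequality.\<close>
  have "((\<lambda>s. c (- s)) has_vector_derivative - d) (at 0)"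
    using vector_diff_chain_at[of uminus "-1" 0 c d] c
    by (simp add: o_def has_vector_derivative_minus[OF has_vector_derivative_id, unfolded id_def])
  moreover have "\<forall>\<^sub>F s in at 0. c (- s) \<in> Q"
  proof -
    have "filterlim uminus (at 0) (at (0::real))"
      unfolding filterlim_at by (auto intro!: tendsto_eq_intros simp: eventually_at_filter)
    with cQ show ?thesis by (auto simp: filterlim_iff)
  qed
  ultimately have "w \<bullet> - d \<le> 0"
    using c by (intro frechet_normal_cone_inner_velocity_le[OF w, of "\<lambda>s. c (- s)"]) auto
  with frechet_normal_cone_inner_velocity_le[OF assms] show ?thesis by simp
qed

section \<open>Normals and tangents of a single manifold\<close>

lemma tangent_vector_chart:
  fixes \<phi> :: "'a::euclidean_space \<Rightarrow> 'b::euclidean_space"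
  assumes t: "t \<in> tangent_space M z"
    and U: "open U" "z \<in> U"
    and \<phi>: "(\<phi> has_derivative D) (at z)"
    and S: "subspace S" "\<phi> ` (M \<inter> U) \<subseteq> S"
  shows "D t \<in> S"
proof -
  obtain \<gamma> e where \<gamma>: "0 < e" "\<gamma> ` {-e<..<e} \<subseteq> M" "\<gamma> 0 = z"
    "(\<gamma> has_vector_derivative t) (at 0)"
    using t unfolding tangent_space_def by blast
  have cont: "(\<gamma> \<longlongrightarrow> z) (at 0)"
    using has_vector_derivative_continuous[OF \<gamma>(4)] \<gamma>(3) by (simp add: continuous_within)
  have der: "((\<phi> \<circ> \<gamma>) has_vector_derivative D t) (at 0)"
    using vector_derivative_diff_chain_within[OF \<gamma>(4), of \<phi> D] \<phi> \<gamma>(3)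
    by (simp add: has_derivative_at_withinI)
  have lim: "((\<lambda>s. ((\<phi> \<circ> \<gamma>) s - \<phi> z) /\<^sub>R s) \<longlongrightarrow> D t) (at 0)"
    using has_vector_derivative_imp_tendsto_quotient[OF der] \<gamma>(3) by simp
  have z: "z \<in> M" using \<gamma> by force
  have "\<forall>\<^sub>F s in at 0. \<gamma> s \<in> U"
    using topological_tendstoD[OF cont U] .
  moreover have "\<forall>\<^sub>F s in at 0. s \<in> {-e<..<e}"
    using \<gamma>(1) by (intro eventually_at_in_open') auto
  ultimately have "\<forall>\<^sub>F s in at 0. ((\<phi> \<circ> \<gamma>) s - \<phi> z) /\<^sub>R s \<in> S"
  proof eventually_elim
    case (elim s)
    then have "\<gamma> s \<in> M \<inter> U" "z \<in> M \<inter> U" using \<gamma>(2) z U by auto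
    then have "\<phi> (\<gamma> s) \<in> S" "\<phi> z \<in> S" using S(2) by blast+
    then show ?case using S(1) by (simp add: subspace_diff subspace_scale)
  qed
  \<comment> \<open>The difference quotients of the curve in the chart lie in \<open>S\<close>, and
    a subspace of a Euclidean space is closed, so their limit stays in \<open>S\<close>.\<close>
  then show ?thesis
    using Lim_in_closed_set[OF closed_subspace[OF S(1)] _ _ lim] by simp
qed

text \<open>
  A tangent vector at \<open>z\<close> is carried by a chart to tangent vectors at nearby points, depending
  continuously on the point. Hence orthogonality to Frechet normals passes to the limit.
\<close>

lemma limiting_normal_cone_orthogonal_tangent_space:
  assumes M: "C1_manifold M" and z: "z \<in> M"
    and v: "v \<in> limiting_normal_cone M z" and t: "t \<in> tangent_space M z"
  shows "v \<bullet> t = 0"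
proof -
  obtain U V \<phi> \<psi> and S :: "'a set" where U: "open U" "z \<in> U" and V: "open V"
    and hom: "homeomorphism U V \<phi> \<psi>" and C1: "C1_map_on U \<phi>" "C1_map_on V \<psi>"
    and S: "subspace S" "\<phi> ` (M \<inter> U) = S \<inter> V"
    using M z unfolding C1_manifold_def by metis
  obtain \<phi>' where \<phi>': "\<And>x. x \<in> U \<Longrightarrow> (\<phi> has_derivative blinfun_apply (\<phi>' x)) (at x)"
    using C1(1) unfolding C1_map_on_def by blast
  obtain \<psi>' where \<psi>': "\<And>x. x \<in> V \<Longrightarrow> (\<psi> has_derivative blinfun_apply (\<psi>' x)) (at x)"
    and \<psi>'_cont: "continuous_on V \<psi>'"
    using C1(2) unfolding C1_map_on_def by blast
  obtain x w where x: "\<And>i. x i \<in> M" "x \<longlonglongrightarrow> z" and w: "\<And>i. w i \<in> frechet_normal_cone M (x i)" "w \<longlonglongrightarrow> v"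
    using v unfolding limiting_normal_cone_def by blast
  \<comment> \<open>The tangent vector \<open>t\<close> read in the chart. Keeping \<open>d\<close>
    fixed and pulling it back at \<open>\<phi> (x i)\<close> yields the nearby tangent vectors
    \<open>\<psi>' (\<phi> (x i)) d\<close>.\<close>
  define d where "d = \<phi>' z t"
  have d: "d \<in> S"
    unfolding d_def using tangent_vector_chart[OF t U \<phi>'[OF U(2)] S(1)] S(2) by blast
  have \<phi>z: "\<phi> z \<in> V" using hom U(2) by (auto simp: homeomorphism_def)
  \<comment> \<open>Since \<open>\<psi> \<circ> \<phi>\<close> is the identity near
    \<open>z\<close>, uniqueness of derivatives shows that pulling \<open>d\<close> back at
    \<open>\<phi> z\<close> recovers \<open>t\<close>.\<close>
  have "(\<psi> \<circ> \<phi> has_derivative \<psi>' (\<phi> z) \<circ> \<phi>' z) (at z)"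
    using diff_chain_at[OF \<phi>'[OF U(2)] \<psi>'[OF \<phi>z]] .
  moreover have "(\<psi> \<circ> \<phi> has_derivative id) (at z)"
    unfolding id_def using hom U
    by (intro has_derivative_transform_within_open[OF has_derivative_ident U])
      (auto simp: homeomorphism_def)
  ultimately have "\<psi>' (\<phi> z) \<circ> \<phi>' z = id"
    by (rule has_derivative_unique)
  then have t_eq: "\<psi>' (\<phi> z) d = t" by (auto simp: d_def fun_eq_iff)
  \<comment> \<open>The test curve is the preimage under the chart of the line through
    \<open>\<phi> (x i)\<close> in direction \<open>d\<close>.\<close>
  have orth: "w i \<bullet> \<psi>' (\<phi> (x i)) d = 0" if i: "x i \<in> U" for i
  proof (rule frechet_normal_cone_inner_velocity[OF w(1)])
    have \<phi>x: "\<phi> (x i) \<in> S \<inter> V" using S(2) i x(1) by blast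
    have line: "((\<lambda>s. \<phi> (x i) + s *\<^sub>R d) has_vector_derivative d) (at 0)"
      by (auto intro!: derivative_eq_intros simp: has_vector_derivative_def)
    show "((\<lambda>s. \<psi> (\<phi> (x i) + s *\<^sub>R d)) has_vector_derivative \<psi>' (\<phi> (x i)) d) (at 0)"
      using vector_derivative_diff_chain_within[OF line, of \<psi> "\<psi>' (\<phi> (x i))"] \<psi>'[of "\<phi> (x i)"] \<phi>x
      by (simp add: o_def has_derivative_at_withinI)
    show "\<psi> (\<phi> (x i) + 0 *\<^sub>R d) = x i"
      using hom i by (simp add: homeomorphism_def)
    \<comment> \<open>The line never leaves \<open>S\<close>, and for small \<open>s\<close> it
      stays in the open set \<open>V\<close>. Points of \<open>S \<inter> V\<close> are images of
      points of \<open>M\<close>, so \<open>\<psi>\<close> sends the line back into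
      \<open>M\<close>.\<close>
    have "((\<lambda>s. \<phi> (x i) + s *\<^sub>R d) \<longlongrightarrow> \<phi> (x i)) (at 0)"
      by (auto intro!: tendsto_eq_intros)
    then have "\<forall>\<^sub>F s in at 0. \<phi> (x i) + s *\<^sub>R d \<in> V"
      using V \<phi>x by (intro topological_tendstoD) auto
    then show "\<forall>\<^sub>F s in at 0. \<psi> (\<phi> (x i) + s *\<^sub>R d) \<in> M"
    proof eventually_elim
      case (elim s)
      then have "\<phi> (x i) + s *\<^sub>R d \<in> S \<inter> V"
        using \<phi>x d S(1) by (auto intro: subspace_add subspace_scale)
      then obtain y where "y \<in> M \<inter> U" "\<phi> (x i) + s *\<^sub>R d = \<phi> y" using S(2) by blast
      then show ?case using hom by (auto simp: homeomorphism_def)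
    qed
  qed
  have "\<forall>\<^sub>F i in sequentially. x i \<in> U"
    using topological_tendstoD[OF x(2) U] .
  then have "\<forall>\<^sub>F i in sequentially. w i \<bullet> \<psi>' (\<phi> (x i)) d = 0"
    by eventually_elim (rule orth)
  then have "(\<lambda>i. w i \<bullet> \<psi>' (\<phi> (x i)) d) \<longlonglongrightarrow> 0"
    by (rule tendsto_eventually)
  moreover have "(\<lambda>i. w i \<bullet> \<psi>' (\<phi> (x i)) d) \<longlonglongrightarrow> v \<bullet> t"
  proof -
    \<comment> \<open>Here the class C1 of \<open>\<psi>\<close> enters: \<open>\<psi>'\<close> is
      continuous in the operator norm, so the transported tangent vectors converge to
      \<open>t\<close>.\<close>
    have "isCont \<psi>' (\<phi> z)"
      using \<psi>'_cont V \<phi>z by (simp add: continuous_on_eq_continuous_at)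
    moreover have "(\<lambda>i. \<phi> (x i)) \<longlonglongrightarrow> \<phi> z"
      using has_derivative_continuous[OF \<phi>'[OF U(2)]] x(2) isCont_tendsto_compose by blast
    ultimately have "(\<lambda>i. \<psi>' (\<phi> (x i))) \<longlonglongrightarrow> \<psi>' (\<phi> z)"
      by (rule isCont_tendsto_compose)
    then have "(\<lambda>i. w i \<bullet> \<psi>' (\<phi> (x i)) d) \<longlonglongrightarrow> v \<bullet> \<psi>' (\<phi> z) d"
      using w(2) by (intro tendsto_intros)
    then show ?thesis by (simp only: t_eq)
  qed
  ultimately show ?thesis using LIMSEQ_unique by blast
qed

section \<open>From the strata to the Clarke normal cone and the coderivative\<close>

lemma limiting_normal_cone_subset_stratum:
  assumes strat: "whitney_a_C1_stratification Q \<S>" and M: "M \<in> \<S>" "z \<in> M"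
  shows "limiting_normal_cone Q z \<subseteq> limiting_normal_cone M z"
proof
  fix v assume "v \<in> limiting_normal_cone Q z"
  then obtain x w where x: "\<And>i. x i \<in> Q" "x \<longlonglongrightarrow> z"
    and w: "\<And>i. w i \<in> frechet_normal_cone Q (x i)" "w \<longlonglongrightarrow> v"
    unfolding limiting_normal_cone_def by blast
  have fin: "finite \<S>" and part: "partition_on Q \<S>" and whitney: "whitney_condition_a \<S>"
    using strat unfolding whitney_a_C1_stratification_def by blast+
  have Q: "Q = \<Union>\<S>" using part by (simp add: partition_on_def)
  have "\<exists>K. K \<in> \<S> \<and> x i \<in> K" for i using x(1)[of i] Q by blast
  then obtain k where k: "\<And>i. k i \<in> \<S>" "\<And>i. x i \<in> k i" by metis
  have "finite (range k)" using k(1) fin by (blast intro: finite_subset)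
  then obtain j where inf: "infinite {i. k i = k j}"
    using pigeonhole_infinite[of "UNIV :: nat set" k] by auto
  \<comment> \<open>The increasing enumeration of the infinitely many indices whose points lie in
    the one stratum \<open>k j\<close>; it is the subsequence to which condition (a) is
    applied.\<close>
  define \<sigma> where "\<sigma> = enumerate {i. k i = k j}"
  have mono: "strict_mono \<sigma>" unfolding \<sigma>_def using inf by (rule strict_mono_enumerate)
  have \<sigma>: "k (\<sigma> i) = k j" for i unfolding \<sigma>_def using enumerate_in_set[OF inf, of i] by simp
  have "x (\<sigma> i) \<in> k j" for i using k(2)[of "\<sigma> i"] by (simp only: \<sigma>)
  \<comment> \<open>Condition (a) is phrased with limiting normals, so each Frechet normal is
    restricted to the stratum and then regarded as the limit of a constant sequence.\<close>
  moreover have "w (\<sigma> i) \<in> limiting_normal_cone (k j) (x (\<sigma> i))" for i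
  proof (rule subsetD[OF frechet_normal_cone_subset_limiting])
    show "x (\<sigma> i) \<in> k j" by fact
    have "k j \<subseteq> Q" unfolding Q by (rule Union_upper) (rule k(1))
    with w(1) show "w (\<sigma> i) \<in> frechet_normal_cone (k j) (x (\<sigma> i))"
      by (rule frechet_normal_cone_antimono)
  qed
  moreover have "(\<lambda>i. x (\<sigma> i)) \<longlonglongrightarrow> z" "(\<lambda>i. w (\<sigma> i)) \<longlonglongrightarrow> v"
    using LIMSEQ_subseq_LIMSEQ[OF x(2) mono] LIMSEQ_subseq_LIMSEQ[OF w(2) mono]
    by (simp_all only: comp_def)
  \<comment> \<open>\<open>whitney_condition_a\<close> lets the two strata coincide, so
    \<open>k j = M\<close> is no separate case.\<close>
  ultimately show "v \<in> limiting_normal_cone M z"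
    using M(2) by (intro whitney[unfolded whitney_condition_a_def, rule_format, OF M(1) k(1)[of j]]
        conjI allI)
qed

lemma clarke_normal_cone_orthogonal_tangent_space:
  assumes strat: "whitney_a_C1_stratification Q \<S>" and M: "M \<in> \<S>" "z \<in> M"
    and v: "v \<in> clarke_normal_cone Q z" and t: "t \<in> tangent_space M z"
  shows "v \<bullet> t = 0"
proof -
  have "C1_manifold M" using strat M unfolding whitney_a_C1_stratification_def by blast
  then have "limiting_normal_cone Q z \<subseteq> {v. t \<bullet> v = 0}"
    using limiting_normal_cone_subset_stratum[OF strat M]
      limiting_normal_cone_orthogonal_tangent_space[OF _ M(2) _ t]
    by (auto simp: inner_commute)
  \<comment> \<open>The vectors orthogonal to \<open>t\<close> form a closed convex set, which
    therefore contains the closed convex hull as soon as it contains the limiting normals.\<close>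
  then have "clarke_normal_cone Q z \<subseteq> {v. t \<bullet> v = 0}"
    unfolding clarke_normal_cone_def
    by (intro closure_minimal hull_minimal convex_hyperplane closed_hyperplane)
  with v show ?thesis by (auto simp: inner_commute)
qed

theorem theorem3p2:
  fixes F :: "real ^ 'n \<Rightarrow> (real ^ 'm) set"
    and \<S> :: "((real ^ 'n) \<times> (real ^ 'm)) set set"
    and M :: "((real ^ 'n) \<times> (real ^ 'm)) set"
    and xb :: "real ^ 'n" and yb u :: "real ^ 'm"
  assumes "whitney_a_C1_stratification (gph F) \<S>"
    and "(xb, yb) \<in> gph F"
    and "M \<in> \<S>" and "(xb, yb) \<in> M"
  shows "\<forall>a \<in> par (clarke_coderivative F xb yb u).
         \<forall>b \<in> fst ` tangent_space M (xb, yb). orthogonal a b"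
proof (intro ballI)
  fix a b
  assume a: "a \<in> par (clarke_coderivative F xb yb u)"
    and "b \<in> fst ` tangent_space M (xb, yb)"
  then obtain t where t: "t \<in> tangent_space M (xb, yb)" "b = fst t" by blast
  have "orthogonal b c" if c_diff: "c \<in> {p - q | p q. p \<in> clarke_coderivative F xb yb u \<and>
      q \<in> clarke_coderivative F xb yb u}" for c
  proof -
    obtain p q where c: "c = p - q" and pq: "p \<in> clarke_coderivative F xb yb u"
      "q \<in> clarke_coderivative F xb yb u"
      using c_diff by blast
    \<comment> \<open>Both equations contain the same term \<open>- u \<bullet> snd t\<close>;
      subtracting them leaves \<open>(p - q) \<bullet> fst t = 0\<close>.\<close>
    have "(p, - u) \<bullet> t = 0" "(q, - u) \<bullet> t = 0"
      using pq clarke_normal_cone_orthogonal_tangent_space[OF assms(1,3,4) _ t(1)]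
      unfolding clarke_coderivative_def by auto
    then show ?thesis
      by (simp add: c t(2) orthogonal_def inner_prod_def inner_diff_right inner_commute)
  qed
  \<comment> \<open>Orthogonality to the differences that generate \<open>par\<close> extends to
    their span by linearity.\<close>
  then have "orthogonal b a"
    using a orthogonal_to_span unfolding par_def by blast
  then show "orthogonal a b" by (simp add: orthogonal_commute)
qed

end
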